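(* Let $(\mathcal A,\mathcal A_0,(-),\preceq)$ be a system over $\mathcal T$ which is a paired domain and whose surpassing relation is $\mathcal T$-reversible. If $(\mathcal A,\mathcal A_0)$ is null-archimedean, then it is $\mathcal T$-ubiquitous, i.e., for all tangible polynomials $f,g\in\mathcal A[\lambda]$ with $f\equiv g$ one has $f\equiv(f;g)\equiv g$.
   Context: **Pairs and systems.** $\mathcal T$ is a commutative monoid with unit $\mathbf 1$. A $\mathcal T$-module is a commutative additive semigroup $(\mathcal A,+,\mathbf 0)$ with neutral element $\mathbf 0$ and an action $\mathcal T\times\mathcal A\to\mathcal A$ with $a_1(a_2b)=(a_1a_2)b$, $a\mathbf 0=\mathbf 0$, $a(b_1+b_2)=ab_1+ab_2$, $\mathbf 1b=b$. Standing assumptions: $\mathcal T\subseteq\mathcal A$; $\mathcal T_0:=\mathcal T\cup\{\mathbf 0\}$ is a monoid acting on $\mathcal A$ with $\mathbf 0b=\mathbf 0$; every element of $\mathcal A$ is a finite sum of elements of $\mathcal T_0$; if $ab_1=ab_2$ with $a\in\mathcal T$ then $b_1=b_2$. A pair $(\mathcal A,\mathcal A_0)$ is a $\mathcal T$-module with a $\mathcal T$-submodule $\mathcal A_0$ such that $ab\in\mathcal A_0$ ($a\in\mathcal T$, $b\in\mathcal A$) implies $b\in\mathcal A_0$. All pairs are uniquely negated: there is a unique element $(-)\mathbf 1\in\mathcal T$ such that, writing $(-)b=((-)\mathbf 1)b$, $b_1(-)b_2=b_1+((-)b_2)$, $b^\circ=b(-)b$: $((-)\mathbf 1)^2=\mathbf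 1$; $e:=\mathbf 1(-)\mathbf 1\in\mathcal A_0$; if $a+a'\in\mathcal A_0$ with $a,a'\in\mathcal T$ then $a'=(-)a$; and $b^\circ\in\mathcal A_0$ for all $b\in\mathcal A$. A surpassing relation $\preceq$ is a pre-order on $\mathcal A$ such that for $a\in\mathcal T$, $b_1\preceq b_2\iff ab_1\preceq ab_2$; $b_i\preceq b_i'$ ($i=1,2$) implies $b_1+b_2\preceq b_1'+b_2'$; $b\in\mathcal A_0$ implies $\mathbf 0\preceq b$; and $a_1\preceq a_2$ with $a_1,a_2\in\mathcal T_0$ implies $a_1=a_2$. A system is the data $(\mathcal A,\mathcal A_0,(-),\preceq)$. **Further notions.** $\preceq$ is $\mathcal T$-reversible if, for $a_i\in\mathcal T$, $(-)a_0\preceq\sum_{i=1}^na_i$ implies $(-)a_1\preceq a_0+\sum_{i=2}^na_i$. The system is a paired domain if $a_1b(-)a_2b\in\mathcal A_0$ with $a_1\neq a_2\in\mathcal T$, $b\in\mathcal A$ implies $b\in\mathcal A_0$. **Polynomials.** $\mathcal A[\lambda]$ is the set of polynomials with coefficients in $\mathcal A$, added coefficientwise; $(-)$ is applied coefficientwise and $g^\circ=g(-)g$. For $g=\sum b_j\lambda^j$ and $a\in\mathcal T_0$, $g(a)=\sum b_ja^j$; $\operatorname{supp}g=\{j:b_j\ne\mathbf 0\}$. $g$ is null if $g(a)\in\mathcal A_0$ for all $a\in\mathcal T$; $g$ is tangible if it is not null and all its coefficients lie in $\mathcal T_0$. $a\in\mathcal T_0$ is a null root of $g$ if $g(a)\in\mathcal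 A_0$. "Almost all" means all but finitely many. $f\equiv g$ means $f(a)=g(a)$ for almost all $a\in\mathcal T$. $(f;g)$ denotes the common sub-polynomial of $f$ and $g$: the sum of those monomials common to both, so $f=(f;g)+\bar f$ and $g=(f;g)+\bar g$ with $\operatorname{supp}(f;g)$ disjoint from $\operatorname{supp}\bar f$ and $\operatorname{supp}\bar g$. A polynomial $h$ essentially dominates a polynomial $g$ if $g+h\equiv h$. $(\mathcal A,\mathcal A_0)$ is null-archimedean if for all tangible polynomials $g,h$, either $h$ essentially dominates $g$ or $g^\circ+h$ has infinitely many null roots. *)

theory Defs
  imports "HOL-Computational_Algebra.Polynomial"
begin

text \<open>
  The module \<open>\<A>\<close> is the whole type \<open>'a\<close>, and \<open>\<T>\<close> is a subset of it.  Since \<open>\<T> \<subseteq> \<A>\<close>, one operation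
  serves both as the action of \<open>\<T>\<^sub>0 = \<T> \<union> {0}\<close> on \<open>\<A>\<close> and, restricted to \<open>\<T>\<^sub>0\<close>, as the
  multiplication of that monoid.  Nothing is assumed about \<open>a \<cdot> b\<close> when \<open>a \<notin> \<T>\<^sub>0\<close>.
\<close>

locale T_module =
  fixes T :: "'a::comm_monoid_add set"
    and one :: 'a  ("\<one>")
    and act :: "'a \<Rightarrow> 'a \<Rightarrow> 'a"  (infixr "\<cdot>" 70)
  assumes one_in_T: "\<one> \<in> T"
    and T_closed: "\<lbrakk>a \<in> T; b \<in> T\<rbrakk> \<Longrightarrow> a \<cdot> b \<in> T"
    and T_commute: "\<lbrakk>a \<in> T; b \<in> T\<rbrakk> \<Longrightarrow> a \<cdot> b = b \<cdot> a"
    and act_assoc: "\<lbrakk>a1 \<in> T; a2 \<in> T\<rbrakk> \<Longrightarrow> a1 \<cdot> (a2 \<cdot> b) = (a1 \<cdot> a2) \<cdot> b"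
    and act_zero: "a \<in> T \<Longrightarrow> a \<cdot> 0 = 0"
    and act_add: "a \<in> T \<Longrightarrow> a \<cdot> (b1 + b2) = a \<cdot> b1 + a \<cdot> b2"
    and one_act: "\<one> \<cdot> b = b"
    and zero_act: "0 \<cdot> b = 0"
    and sums_of_T0: "\<exists>xs. set xs \<subseteq> T \<union> {0} \<and> b = sum_list xs"
    and act_cancel: "\<lbrakk>a \<in> T; a \<cdot> b1 = a \<cdot> b2\<rbrakk> \<Longrightarrow> b1 = b2"
begin

definition T0 :: "'a set" where
  "T0 = T \<union> {0}"

primrec tpow :: "'a \<Rightarrow> nat \<Rightarrow> 'a" where
  "tpow a 0 = \<one>"
| "tpow a (Suc n) = a \<cdot> tpow a n"

text \<open>The coefficients lie in a module only, so the library's \<^const>\<open>poly\<close> does not apply.\<close>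

definition peval :: "'a poly \<Rightarrow> 'a \<Rightarrow> 'a" where
  "peval g a = (\<Sum>j\<le>degree g. tpow a j \<cdot> coeff g j)"

definition psupp :: "'a poly \<Rightarrow> nat set" where
  "psupp g = {j. coeff g j \<noteq> 0}"

definition ess_equal :: "'a poly \<Rightarrow> 'a poly \<Rightarrow> bool"  (infix "\<equiv>\<^sub>e" 50) where
  "f \<equiv>\<^sub>e g \<longleftrightarrow> finite {a \<in> T. peval f a \<noteq> peval g a}"

definition common_subpoly :: "'a poly \<Rightarrow> 'a poly \<Rightarrow> 'a poly" where
  "common_subpoly f g =
     (\<Sum>j \<in> {j \<in> psupp f \<inter> psupp g. coeff f j = coeff g j}. monom (coeff f j) j)"

definition ess_dominates :: "'a poly \<Rightarrow> 'a poly \<Rightarrow> bool" where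
  "ess_dominates h g \<longleftrightarrow> g + h \<equiv>\<^sub>e h"

end

locale module_pair = T_module T one act
  for T :: "'a::comm_monoid_add set"
    and one :: 'a  ("\<one>")
    and act :: "'a \<Rightarrow> 'a \<Rightarrow> 'a"  (infixr "\<cdot>" 70) +
  fixes A0 :: "'a set"
  assumes A0_zero: "0 \<in> A0"
    and A0_add: "\<lbrakk>b1 \<in> A0; b2 \<in> A0\<rbrakk> \<Longrightarrow> b1 + b2 \<in> A0"
    and A0_act: "\<lbrakk>a \<in> T; b \<in> A0\<rbrakk> \<Longrightarrow> a \<cdot> b \<in> A0"
    and A0_act_cancel: "\<lbrakk>a \<in> T; a \<cdot> b \<in> A0\<rbrakk> \<Longrightarrow> b \<in> A0"
begin

definition is_neg_one :: "'a \<Rightarrow> bool" where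
  "is_neg_one n \<longleftrightarrow>
     n \<in> T \<and> n \<cdot> n = \<one> \<and> \<one> + n \<cdot> \<one> \<in> A0 \<and>
     (\<forall>a\<in>T. \<forall>a'\<in>T. a + a' \<in> A0 \<longrightarrow> a' = n \<cdot> a) \<and>
     (\<forall>b. b + n \<cdot> b \<in> A0)"

definition null_poly :: "'a poly \<Rightarrow> bool" where
  "null_poly g \<longleftrightarrow> (\<forall>a\<in>T. peval g a \<in> A0)"

definition tangible :: "'a poly \<Rightarrow> bool" where
  "tangible g \<longleftrightarrow> \<not> null_poly g \<and> (\<forall>j. coeff g j \<in> T0)"

definition null_root :: "'a poly \<Rightarrow> 'a \<Rightarrow> bool" where
  "null_root g a \<longleftrightarrow> a \<in> T0 \<and> peval g a \<in> A0"

definition T_ubiquitous :: bool where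
  "T_ubiquitous \<longleftrightarrow>
     (\<forall>f g. tangible f \<and> tangible g \<and> f \<equiv>\<^sub>e g \<longrightarrow>
        f \<equiv>\<^sub>e common_subpoly f g \<and> common_subpoly f g \<equiv>\<^sub>e g)"

end

locale uniquely_negated_pair = module_pair T one act A0
  for T :: "'a::comm_monoid_add set"
    and one :: 'a  ("\<one>")
    and act :: "'a \<Rightarrow> 'a \<Rightarrow> 'a"  (infixr "\<cdot>" 70)
    and A0 :: "'a set" +
  fixes neg_one :: 'a
  assumes neg_one: "is_neg_one neg_one"
    and neg_one_unique: "is_neg_one n \<Longrightarrow> n = neg_one"
begin

definition neg :: "'a \<Rightarrow> 'a" where
  "neg b = neg_one \<cdot> b"

definition pneg :: "'a poly \<Rightarrow> 'a poly" where
  "pneg g = map_poly neg g"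

definition pquasi :: "'a poly \<Rightarrow> 'a poly" where
  "pquasi g = g + pneg g"

definition paired_domain :: bool where
  "paired_domain \<longleftrightarrow>
     (\<forall>a1\<in>T. \<forall>a2\<in>T. \<forall>b. a1 \<noteq> a2 \<and> a1 \<cdot> b + neg (a2 \<cdot> b) \<in> A0 \<longrightarrow> b \<in> A0)"

definition null_archimedean :: bool where
  "null_archimedean \<longleftrightarrow>
     (\<forall>g h. tangible g \<and> tangible h \<longrightarrow>
        ess_dominates h g \<or> infinite {a. null_root (pquasi g + h) a})"

end

locale system = uniquely_negated_pair T one act A0 neg_one
  for T :: "'a::comm_monoid_add set"
    and one :: 'a  ("\<one>")
    and act :: "'a \<Rightarrow> 'a \<Rightarrow> 'a"  (infixr "\<cdot>" 70)
    and A0 :: "'a set"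
    and neg_one :: 'a +
  fixes surp :: "'a \<Rightarrow> 'a \<Rightarrow> bool"  (infix "\<preceq>" 50)
  assumes surp_refl: "b \<preceq> b"
    and surp_trans: "\<lbrakk>b1 \<preceq> b2; b2 \<preceq> b3\<rbrakk> \<Longrightarrow> b1 \<preceq> b3"
    and surp_act: "a \<in> T \<Longrightarrow> b1 \<preceq> b2 \<longleftrightarrow> a \<cdot> b1 \<preceq> a \<cdot> b2"
    and surp_add: "\<lbrakk>b1 \<preceq> b1'; b2 \<preceq> b2'\<rbrakk> \<Longrightarrow> b1 + b2 \<preceq> b1' + b2'"
    and surp_A0: "b \<in> A0 \<Longrightarrow> 0 \<preceq> b"
    and surp_T0: "\<lbrakk>a1 \<in> T0; a2 \<in> T0; a1 \<preceq> a2\<rbrakk> \<Longrightarrow> a1 = a2"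
begin

definition T_reversible :: bool where
  "T_reversible \<longleftrightarrow>
     (\<forall>n\<ge>1. \<forall>a :: nat \<Rightarrow> 'a. (\<forall>i\<le>n. a i \<in> T) \<longrightarrow>
        neg (a 0) \<preceq> (\<Sum>i=1..n. a i) \<longrightarrow>
        neg (a 1) \<preceq> a 0 + (\<Sum>i=2..n. a i))"

end

end

theory Submission imports Defs begin

text \<open>
  Applied to constant polynomials, null-archimedeanness says that \<open>a + b = b\<close> or \<open>b + a\<^sup>\<circ> \<in> \<A>\<^sub>0\<close>.  If the
  second alternative held for \<open>(a, b)\<close> and for \<open>(b, a)\<close>, repeated use of the paired domain property
  would force \<open>a = \<plusminus>b\<close>.  Hence \<open>\<T>\<close> is totally ordered up to sign by ``\<open>b\<close> absorbs \<open>\<plusminus>a\<close>'', compatibly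
  with multiplication, so \<open>x \<mapsto> x\<^sup>m\<close> is injective up to sign and monomials of different degrees agree
  up to sign at finitely many points only.  At almost every point the value of a polynomial with
  coefficients in \<open>\<T>\<^sub>0\<close> is therefore a single dominant monomial, and where \<open>f(x) = g(x)\<close> the dominant
  monomials of \<open>f\<close> and \<open>g\<close> coincide.
\<close>

section \<open>Powers, evaluation and the common sub-polynomial\<close>

context T_module
begin

lemma act_left_commute: "\<lbrakk>a \<in> T; b \<in> T\<rbrakk> \<Longrightarrow> a \<cdot> b \<cdot> c = b \<cdot> a \<cdot> c"
  by (simp add: act_assoc T_commute)

lemma act_one: "a \<in> T \<Longrightarrow> a \<cdot> \<one> = a"
  using T_commute[OF _ one_in_T] one_act by simp

lemmas act_simps = act_assoc[symmetric] T_closed act_add act_left_commute T_commute act_one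

lemma tpow_in_T: "a \<in> T \<Longrightarrow> tpow a j \<in> T"
  by (induction j) (auto simp: one_in_T T_closed)

lemma tpow_add: "a \<in> T \<Longrightarrow> tpow a (i + j) = tpow a i \<cdot> tpow a j"
  by (induction i) (auto simp: one_act act_assoc tpow_in_T)

lemma finite_psupp: "finite (psupp f)"
  using le_degree by (force simp: psupp_def intro: finite_subset[of _ "{..degree f}"])

lemma peval_eq_sum_psupp:
  assumes "a \<in> T"
  shows "peval f a = (\<Sum>j\<in>psupp f. tpow a j \<cdot> coeff f j)"
  unfolding peval_def
proof (rule sum.mono_neutral_right)
  show "psupp f \<subseteq> {..degree f}"
    by (auto simp: psupp_def le_degree)
qed (auto simp: psupp_def act_zero tpow_in_T assms)

lemma coeff_common_subpoly:
  "coeff (common_subpoly f g) j = (if coeff f j = coeff g j then coeff f j else 0)"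
proof -
  let ?S = "{j \<in> psupp f \<inter> psupp g. coeff f j = coeff g j}"
  have fin: "finite ?S"
    using finite_psupp[of f] by simp
  have "coeff (common_subpoly f g) j = (\<Sum>i\<in>?S. if i = j then coeff f i else 0)"
    by (simp only: common_subpoly_def coeff_sum coeff_monom)
  also have "\<dots> = (if j \<in> ?S then coeff f j else 0)"
    using fin by (simp only: sum.delta)
  finally show ?thesis
    by (auto simp: psupp_def)
qed

end

section \<open>Negation and absorption\<close>

context uniquely_negated_pair
begin

lemma neg_one_in_T: "neg_one \<in> T"
  and neg_one_square: "neg_one \<cdot> neg_one = \<one>"
  and negated_sum: "\<lbrakk>a \<in> T; a' \<in> T; a + a' \<in> A0\<rbrakk> \<Longrightarrow> a' = neg a"
  and quasi_zero_in_A0: "b + neg b \<in> A0"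
  using neg_one by (auto simp: is_neg_one_def neg_def)

lemma neg_neg: "neg (neg b) = b"
  by (simp add: neg_def act_assoc neg_one_in_T neg_one_square one_act)

lemma neg_in_T: "a \<in> T \<Longrightarrow> neg a \<in> T"
  by (simp add: neg_def neg_one_in_T T_closed)

lemma neg_zero: "neg 0 = 0"
  by (simp add: neg_def neg_one_in_T act_zero)

lemma neg_act: "a \<in> T \<Longrightarrow> neg (a \<cdot> b) = a \<cdot> neg b"
  by (simp add: neg_def neg_one_in_T act_left_commute)

lemma neg_act_left: "a \<in> T \<Longrightarrow> neg a \<cdot> b = neg (a \<cdot> b)"
  by (simp add: neg_def neg_one_in_T act_assoc)

lemma neg_in_A0: "b \<in> A0 \<Longrightarrow> neg b \<in> A0"
  by (simp add: neg_def neg_one_in_T A0_act)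

text \<open>If \<open>\<one>\<close> lay in \<open>A0\<close>, so would all of \<open>T0\<close> and
  hence all finite sums, which exhaust the module; every polynomial would then be null.\<close>

lemma tangible_one_notin_A0:
  assumes "tangible f"
  shows "\<one> \<notin> A0"
proof
  assume "\<one> \<in> A0"
  then have "T \<union> {0} \<subseteq> A0"
    using A0_act act_one A0_zero by fastforce
  moreover have "sum_list xs \<in> A0" if "set xs \<subseteq> A0" for xs
    using that by (induction xs) (auto simp: A0_zero A0_add)
  ultimately have "b \<in> A0" for b
    using sums_of_T0[of b] by blast
  then show False
    using assms by (simp add: tangible_def null_poly_def)
qed

text \<open>Asking for both signs makes the relation strict: \<open>a + a = a\<close> may well hold,
  but \<open>neg a + a = a\<close> would put \<open>a\<close> into \<open>A0\<close>.\<close>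

definition absorbed :: "'a \<Rightarrow> 'a \<Rightarrow> bool"  (infix "\<lless>" 50) where
  "a \<lless> b \<longleftrightarrow> a + b = b \<and> neg a + b = b"

lemma absorbed_trans: "\<lbrakk>a \<lless> b; b \<lless> c\<rbrakk> \<Longrightarrow> a \<lless> c"
  unfolding absorbed_def by (metis add.assoc)

lemma absorbed_act: "\<lbrakk>c \<in> T; a \<lless> b\<rbrakk> \<Longrightarrow> c \<cdot> a \<lless> c \<cdot> b"
  unfolding absorbed_def by (metis act_add neg_act)

text \<open>The induction exchanges one factor at a time, passing through
  \<open>a \<cdot> tpow b (Suc m)\<close>. Exponent 0 is left out, as it would claim
  \<open>\<one> \<lless> \<one>\<close>.\<close>

lemma absorbed_tpow:
  assumes "a \<in> T" "b \<in> T" "a \<lless> b"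
  shows "tpow a (Suc m) \<lless> tpow b (Suc m)"
proof (induction m)
  case 0
  then show ?case using assms by (simp add: act_one)
next
  case (Suc m)
  have "a \<cdot> tpow a (Suc m) \<lless> a \<cdot> tpow b (Suc m)"
    using absorbed_act Suc assms(1) by blast
  moreover have "tpow b (Suc m) \<cdot> a \<lless> tpow b (Suc m) \<cdot> b"
    using absorbed_act tpow_in_T assms by blast
  ultimately show ?case
    using absorbed_trans T_commute tpow_in_T assms by (metis tpow.simps(2))
qed

lemma sum_eq_dominant:
  assumes "finite S" "k \<in> S" "\<And>j. j \<in> S \<Longrightarrow> j \<noteq> k \<Longrightarrow> v j \<lless> v k"
  shows "sum v S = v k"
proof -
  have "sum v S' + v k = v k" if "finite S'" "\<And>j. j \<in> S' \<Longrightarrow> v j \<lless> v k" for S'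
    using that by (induction S') (auto simp: absorbed_def add.assoc)
  from this[of "S - {k}"] show ?thesis
    using assms by (simp add: sum.remove add.commute)
qed

lemma dominant_exists:
  assumes "finite S" "S \<noteq> {}"
    and "\<And>i j. \<lbrakk>i \<in> S; j \<in> S; i \<noteq> j\<rbrakk> \<Longrightarrow> v i \<lless> v j \<or> v j \<lless> v i"
  shows "\<exists>k\<in>S. \<forall>j\<in>S. j \<noteq> k \<longrightarrow> v j \<lless> v k"
  using assms
proof (induction rule: finite_ne_induct)
  case (insert i S)
  then obtain k where k: "k \<in> S" "\<forall>j\<in>S. j \<noteq> k \<longrightarrow> v j \<lless> v k"
    by auto
  have "i \<noteq> k" using insert k by auto
  then consider "v i \<lless> v k" | "v k \<lless> v i"
    using insert.prems[of i k] k by auto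
  then show ?case
    using k absorbed_trans by cases (metis insert_iff)+
qed auto

end

text \<open>For finite \<open>T\<close> the relation \<open>\<equiv>\<^sub>e\<close> is trivial, and
  \<open>one_notin_A0\<close> holds as soon as some polynomial is tangible.\<close>

locale null_archimedean_paired_domain = uniquely_negated_pair T one act A0 neg_one
  for T :: "'a::comm_monoid_add set"
    and one :: 'a  ("\<one>")
    and act :: "'a \<Rightarrow> 'a \<Rightarrow> 'a"  (infixr "\<cdot>" 70)
    and A0 :: "'a set"
    and neg_one :: 'a +
  assumes paired: paired_domain
    and null_arch: null_archimedean
    and infinite_T: "infinite T"
    and one_notin_A0: "\<one> \<notin> A0"
begin

section \<open>Totality of absorption up to sign\<close>

lemma paired_cancel:
  "\<lbrakk>a1 \<in> T; a2 \<in> T; a1 \<noteq> a2; a1 \<cdot> b + neg (a2 \<cdot> b) \<in> A0\<rbrakk> \<Longrightarrow> b \<in> A0"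
  using paired unfolding paired_domain_def by blast

lemma T_notin_A0: "a \<in> T \<Longrightarrow> a \<notin> A0"
  using A0_act_cancel act_one one_notin_A0 by metis

lemma T_nonzero: "a \<in> T \<Longrightarrow> a \<noteq> 0"
  using T_notin_A0 A0_zero by blast

lemma absorbed_irrefl: "a \<in> T \<Longrightarrow> \<not> a \<lless> a"
  using T_notin_A0 quasi_zero_in_A0 unfolding absorbed_def by (metis add.commute)

text \<open>Values of constants do not depend on the point, so "almost all" and "infinitely many"
  both collapse to one test.\<close>

lemma constant_dichotomy:
  assumes "a \<in> T" "b \<in> T"
  shows "a + b = b \<or> b + (a + neg a) \<in> A0"
proof -
  have peval_const: "peval [:c:] x = c" for c x
    by (simp add: peval_def one_act)
  have tang: "tangible [:c:]" if "c \<in> T" for c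
    using that T_notin_A0 one_in_T
    by (auto simp: tangible_def null_poly_def peval_const T0_def coeff_pCons split: nat.splits)
  have "pquasi [:a:] + [:b:] = [:b + (a + neg a):]"
    using assms T_nonzero neg_in_T neg_zero by (simp add: pquasi_def pneg_def map_poly_pCons add_ac)
  then have "infinite {x. null_root [:b + (a + neg a):] x} \<or> ess_dominates [:b:] [:a:]"
    using null_arch tang assms unfolding null_archimedean_def by metis
  then show ?thesis
  proof
    assume "infinite {x. null_root [:b + (a + neg a):] x}"
    then show ?thesis
      using not_finite_existsD by (fastforce simp: null_root_def peval_const)
  next
    assume "ess_dominates [:b:] [:a:]"
    then show ?thesis
      using infinite_T by (cases "a + b = b") (auto simp: ess_dominates_def ess_equal_def peval_const)
  qed
qed

text \<open>In the dichotomy for \<open>neg a\<close> and \<open>b\<close>, the second alternative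
  reduces to \<open>b + neg a \<in> A0\<close>, and unique negation would give
  \<open>a = b\<close>.\<close>

lemma absorbedI:
  assumes "a \<in> T" "b \<in> T" "a \<noteq> b" "a + b = b"
  shows "a \<lless> b"
proof -
  have "neg a + b = b \<or> b + (neg a + a) \<in> A0"
    using constant_dichotomy[of "neg a" b] assms neg_in_T neg_neg by simp
  moreover have "b + (neg a + a) = b + neg a"
    using assms(4) by (metis add.assoc add.commute)
  ultimately show ?thesis
    using assms negated_sum[of b "neg a"] neg_in_T neg_neg by (metis absorbed_def)
qed

text \<open>If both absorptions fail, the aim is \<open>a + b \<in> A0\<close>, which unique
  negation turns into the excluded \<open>a = neg b\<close>.\<close>

lemma absorbed_total:
  assumes ab: "a \<in> T" "b \<in> T" "a \<noteq> b" "a \<noteq> neg b"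
  shows "a \<lless> b \<or> b \<lless> a"
proof (rule ccontr)
  assume "\<not> ?thesis"
  then have "a + b \<noteq> b" "b + a \<noteq> a"
    using absorbedI ab by metis+
  then have ba: "b + (a + neg a) \<in> A0" and ab': "a + (b + neg b) \<in> A0"
    using constant_dichotomy ab by blast+
  note n = neg_one_in_T neg_one_square
  have nn: "neg_one \<cdot> neg_one \<cdot> c = c" for c
    using neg_neg by (simp add: neg_def)
  \<comment> \<open>The factor \<open>a\<^sup>2 + b\<^sup>2\<close> can be cancelled by the paired
    domain property only if \<open>a\<^sup>2\<close> differs from \<open>neg (b\<^sup>2)\<close>,
    hence the case split.\<close>
  have "a + b \<in> A0"
  proof (cases "a \<cdot> a = neg (b \<cdot> b)")
    case False
    \<comment> \<open>\<open>(a - b)(a + b)(a\<^sup>2 + b\<^sup>2) = a\<^sup>4 - b\<^sup>4\<close> up to quasi-zeros, which suffice to absorb both powers.\<close>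
    let ?s = "(a \<cdot> a) \<cdot> (a + b) + (b \<cdot> b) \<cdot> (a + b)"
    have "a \<cdot> ?s + neg (b \<cdot> ?s) =
        a \<cdot> a \<cdot> a \<cdot> (a + (b + neg b)) + neg (b \<cdot> b \<cdot> b \<cdot> (b + (a + neg a)))
        + (a \<cdot> a \<cdot> b \<cdot> b + neg (a \<cdot> a \<cdot> b \<cdot> b))"
      using ab n by (simp add: neg_def act_simps nn add_ac)
    moreover have "\<dots> \<in> A0"
      by (rule ba ab' quasi_zero_in_A0 ab A0_add neg_in_A0 A0_act)+
    ultimately have "?s \<in> A0"
      using paired_cancel ab by metis
    then show ?thesis
      using paired_cancel[of "a \<cdot> a" "neg (b \<cdot> b)" "a + b"] False ab T_closed neg_in_T
      by (simp add: neg_act_left neg_neg)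
  next
    case True
    then have bb: "b \<cdot> b = neg (a \<cdot> a)" "b \<cdot> b \<cdot> c = neg (a \<cdot> a \<cdot> c)" for c
      using ab neg_neg n by (simp_all add: neg_def act_assoc T_closed)
    \<comment> \<open>Up to quasi-zeros \<open>(a + b)\<^sup>4 = a\<^sup>4 + 6a\<^sup>2b\<^sup>2 + b\<^sup>4 = -4a\<^sup>4\<close>, absorbed by four copies of \<open>(a\<^sup>3b)\<^sup>\<circ>\<close>.\<close>
    define M where "M s = a \<cdot> s + b \<cdot> s" for s
    have M: "s \<in> A0" if "M s \<in> A0" for s
      using paired_cancel[of a "neg b" s] that ab neg_in_T
      by (simp add: M_def neg_act_left neg_neg)
    let ?w = "a \<cdot> a \<cdot> a \<cdot> a" and ?r = "neg (a \<cdot> a \<cdot> a \<cdot> (a + (b + neg b)))"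
    have "M (M (M (a + b))) = ?r + ?r + ?r + ?r + (?w + neg ?w) + (?w + neg ?w)"
      using ab n by (simp add: M_def act_simps bb neg_def nn add_ac)
    also have "\<dots> \<in> A0"
      by (rule ab' quasi_zero_in_A0 ab A0_add neg_in_A0 A0_act)+
    finally show ?thesis
      using M by blast
  qed
  then show False
    using negated_sum ab neg_neg by metis
qed

section \<open>Agreement and comparability of monomials\<close>

lemma tpow_inj_up_to_neg:
  assumes "x \<in> T" "y \<in> T" "tpow x (Suc m) = tpow y (Suc m)"
  shows "x = y \<or> x = neg y"
  \<comment> \<open>Otherwise absorption between \<open>x\<close> and \<open>y\<close> would pass to
    their equal powers, against irreflexivity.\<close>
  using absorbed_total[OF assms(1,2)] absorbed_tpow absorbed_irrefl tpow_in_T assms by metis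

text \<open>Cancelling \<open>tpow x i\<close> and then \<open>d\<close> shows that all solutions
  share the same power \<open>tpow x (Suc m)\<close>, so there are at most two, \<open>y\<close> and
  \<open>neg y\<close>.\<close>

lemma finite_monomial_agreement_less:
  assumes "c \<in> T" "d \<in> T" "i < j"
  shows "finite {x \<in> T. tpow x i \<cdot> c = tpow x j \<cdot> d}" (is "finite ?E")
proof (cases "?E = {}")
  case False
  obtain m where j: "j = i + Suc m"
    using assms(3) less_iff_Suc_add by auto
  have E: "c = d \<cdot> tpow x (Suc m)" if "x \<in> ?E" for x
  proof -
    have "tpow x i \<cdot> c = tpow x i \<cdot> (tpow x (Suc m) \<cdot> d)"
      using that tpow_add[of x i "Suc m"] unfolding j
      by (simp add: act_assoc tpow_in_T del: tpow.simps add_Suc_right)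
    then show ?thesis
      using that act_cancel T_commute tpow_in_T assms(2) by blast
  qed
  obtain y where y: "y \<in> ?E" using False by blast
  have "x \<in> {y, neg y}" if "x \<in> ?E" for x
  proof -
    have "tpow x (Suc m) = tpow y (Suc m)"
      using E[OF that] E[OF y] act_cancel assms(2) by metis
    then show ?thesis
      using tpow_inj_up_to_neg that y by blast
  qed
  then show ?thesis
    by (rule finite_subset[OF subsetI]) simp_all
next
  case True
  then show ?thesis by (metis finite.emptyI)
qed

lemma finite_monomial_agreement:
  assumes "c \<in> T" "d \<in> T" "i \<noteq> j"
  shows "finite {x \<in> T. tpow x i \<cdot> c = tpow x j \<cdot> d}"
proof (cases "i < j")
  case False
  then have "finite {x \<in> T. tpow x j \<cdot> d = tpow x i \<cdot> c}"
    using finite_monomial_agreement_less assms by simp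
  then show ?thesis
    by (simp add: eq_commute)
qed (simp add: finite_monomial_agreement_less assms)

lemma finite_not_comparable:
  assumes "c \<in> T" "d \<in> T" "i \<noteq> j"
  shows "finite {x \<in> T. \<not> tpow x i \<cdot> c \<lless> tpow x j \<cdot> d \<and> \<not> tpow x j \<cdot> d \<lless> tpow x i \<cdot> c}"
proof -
  \<comment> \<open>The set for \<open>neg d\<close> is removed too, because
    \<open>absorbed_total\<close> excludes equality up to sign.\<close>
  let ?E = "\<lambda>d. {x \<in> T. tpow x i \<cdot> c = tpow x j \<cdot> d}"
  have "tpow x i \<cdot> c \<lless> tpow x j \<cdot> d \<or> tpow x j \<cdot> d \<lless> tpow x i \<cdot> c"
    if "x \<in> T" "x \<notin> ?E d \<union> ?E (neg d)" for x
  proof (rule absorbed_total)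
    show "tpow x i \<cdot> c \<in> T" "tpow x j \<cdot> d \<in> T"
      using that(1) assms by (simp_all add: T_closed tpow_in_T)
    show "tpow x i \<cdot> c \<noteq> tpow x j \<cdot> d" "tpow x i \<cdot> c \<noteq> neg (tpow x j \<cdot> d)"
      using that neg_act[OF tpow_in_T] by auto
  qed
  then have "{x \<in> T. \<not> tpow x i \<cdot> c \<lless> tpow x j \<cdot> d \<and> \<not> tpow x j \<cdot> d \<lless> tpow x i \<cdot> c}
      \<subseteq> ?E d \<union> ?E (neg d)"
    by blast
  moreover have "finite (?E d \<union> ?E (neg d))"
    by (intro finite_UnI finite_monomial_agreement assms neg_in_T)
  ultimately show ?thesis
    by (rule finite_subset)
qed

lemma ubiquitous_for_tangible:
  assumes "tangible f" "tangible g" "f \<equiv>\<^sub>e g"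
  shows "f \<equiv>\<^sub>e common_subpoly f g \<and> common_subpoly f g \<equiv>\<^sub>e g"
proof -
  let ?F = "psupp f" and ?G = "psupp g"
  let ?h = "common_subpoly f g"
  define u v where "u x j = tpow x j \<cdot> coeff f j" and "v x j = tpow x j \<cdot> coeff g j" for x j
  have fT: "coeff f j \<in> T" if "j \<in> ?F" for j
    using assms(1) that by (auto simp: tangible_def T0_def psupp_def)
  have gT: "coeff g j \<in> T" if "j \<in> ?G" for j
    using assms(2) that by (auto simp: tangible_def T0_def psupp_def)
  have ne: "psupp p \<noteq> {}" if "tangible p" for p
    using that A0_zero by (auto simp: tangible_def null_poly_def peval_eq_sum_psupp)
  \<comment> \<open>Avoiding the first two unions yields dominant terms of \<open>f\<close> and of
    \<open>g\<close>; avoiding the third forces these to have the same degree once the values agree,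
    which the last set secures.\<close>
  define bad where "bad =
    (\<Union>i\<in>?F. \<Union>j\<in>?F - {i}. {x \<in> T. \<not> u x i \<lless> u x j \<and> \<not> u x j \<lless> u x i}) \<union>
    (\<Union>i\<in>?G. \<Union>j\<in>?G - {i}. {x \<in> T. \<not> v x i \<lless> v x j \<and> \<not> v x j \<lless> v x i}) \<union>
    (\<Union>i\<in>?F. \<Union>j\<in>?G - {i}. {x \<in> T. u x i = v x j}) \<union>
    {x \<in> T. peval f x \<noteq> peval g x}"
  have "finite bad"
    unfolding bad_def
  proof (intro finite_UnI finite_UN_I finite_Diff finite_psupp)
    fix i j
    show "finite {x \<in> T. \<not> u x i \<lless> u x j \<and> \<not> u x j \<lless> u x i}" if "i \<in> ?F" "j \<in> ?F - {i}"
      unfolding u_def by (rule finite_not_comparable) (use fT that in auto)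
    show "finite {x \<in> T. \<not> v x i \<lless> v x j \<and> \<not> v x j \<lless> v x i}" if "i \<in> ?G" "j \<in> ?G - {i}"
      unfolding v_def by (rule finite_not_comparable) (use gT that in auto)
    show "finite {x \<in> T. u x i = v x j}" if "i \<in> ?F" "j \<in> ?G - {i}"
      unfolding u_def v_def by (rule finite_monomial_agreement) (use fT gT that in auto)
    show "finite {x \<in> T. peval f x \<noteq> peval g x}"
      using assms(3) by (simp add: ess_equal_def)
  qed
  have good: "peval ?h x = peval f x \<and> peval ?h x = peval g x" if x: "x \<in> T" "x \<notin> bad" for x
  proof -
    have pe: "peval f x = sum (u x) ?F" "peval g x = sum (v x) ?G"
      using x(1) by (simp_all add: peval_eq_sum_psupp u_def v_def)
    have cu: "u x i \<lless> u x j \<or> u x j \<lless> u x i" if "i \<in> ?F" "j \<in> ?F" "i \<noteq> j" for i j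
      using x that by (auto simp: bad_def)
    have cv: "v x i \<lless> v x j \<or> v x j \<lless> v x i" if "i \<in> ?G" "j \<in> ?G" "i \<noteq> j" for i j
      using x that by (auto simp: bad_def)
    obtain k where k: "k \<in> ?F" "\<forall>j\<in>?F. j \<noteq> k \<longrightarrow> u x j \<lless> u x k"
      using dominant_exists[OF finite_psupp ne[OF assms(1)], of "u x", OF cu] by blast
    obtain l where l: "l \<in> ?G" "\<forall>j\<in>?G. j \<noteq> l \<longrightarrow> v x j \<lless> v x l"
      using dominant_exists[OF finite_psupp ne[OF assms(2)], of "v x", OF cv] by blast
    have fk: "peval f x = u x k" and gl: "peval g x = v x l"
      unfolding pe using k l by (auto intro!: sum_eq_dominant finite_psupp)
    have eq: "peval f x = peval g x"
      using x by (auto simp: bad_def)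
    then have "k = l"
      using x k(1) l(1) fk gl by (auto simp: bad_def)
    \<comment> \<open>The power \<open>tpow x k\<close> cancels from the equal dominant terms, so
      this monomial survives in \<open>?h\<close>.\<close>
    then have "coeff f k = coeff g k"
      using eq fk gl act_cancel tpow_in_T x(1) unfolding u_def v_def by metis
    then have k_h: "k \<in> psupp ?h"
      using k(1) by (simp add: psupp_def coeff_common_subpoly)
    have h: "j \<in> ?F \<and> coeff ?h j = coeff f j" if "j \<in> psupp ?h" for j
      using that by (auto simp: psupp_def coeff_common_subpoly split: if_splits)
    \<comment> \<open>On its support, contained in that of \<open>f\<close>, \<open>?h\<close> has
      the coefficients of \<open>f\<close>, so term \<open>k\<close> dominates there as
      well.\<close>
    have "peval ?h x = sum (u x) (psupp ?h)"
      using x(1) h by (simp add: peval_eq_sum_psupp u_def)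
    also have "\<dots> = u x k"
      by (rule sum_eq_dominant[OF finite_psupp k_h]) (use k(2) h in auto)
    finally show ?thesis
      using fk eq by simp
  qed
  then have "{x \<in> T. peval f x \<noteq> peval ?h x} \<subseteq> bad" "{x \<in> T. peval ?h x \<noteq> peval g x} \<subseteq> bad"
    by fastforce+
  then show ?thesis
    using \<open>finite bad\<close> by (simp add: ess_equal_def finite_subset)
qed

end

theorem theorem2p43:
  fixes T :: "'a::comm_monoid_add set"
    and one :: 'a
    and act :: "'a \<Rightarrow> 'a \<Rightarrow> 'a"
    and A0 :: "'a set"
    and neg_one :: 'a
    and surp :: "'a \<Rightarrow> 'a \<Rightarrow> bool"
  assumes "system T one act A0 neg_one surp"
    and "uniquely_negated_pair.paired_domain T act A0 neg_one"
    and "system.T_reversible T act neg_one surp"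
    and "uniquely_negated_pair.null_archimedean T one act A0 neg_one"
  shows "module_pair.T_ubiquitous T one act A0"
proof -
  interpret system T one act A0 neg_one surp by fact
  show ?thesis
    unfolding T_ubiquitous_def
  proof (intro allI impI)
    fix f g
    assume fg: "tangible f \<and> tangible g \<and> f \<equiv>\<^sub>e g"
    show "f \<equiv>\<^sub>e common_subpoly f g \<and> common_subpoly f g \<equiv>\<^sub>e g"
    proof (cases "finite T")
      case True
      then show ?thesis by (simp add: ess_equal_def)
    next
      case False
      interpret null_archimedean_paired_domain T one act A0 neg_one
        by unfold_locales (use assms False fg tangible_one_notin_A0 in auto)
      show ?thesis using fg ubiquitous_for_tangible by blast
    qed
  qed
qed

end
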